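(* Let $n\ge1$, let $H\in\mathbb{R}^{n\times n}$ be symmetric positive definite, and let $W=\omega(H)$ be a positive spectral weight. Let $S=W^{1/2}$ and $\mathcal{S}_W(u,v):=(Su,Sv)$, regarded as a map of $\Omega_{\rm BB}(H)$ onto itself, and let $T_I$ denote the transition $T_W$ for $W=I$ (the BB1 transition). Then $$\mathcal{S}_W T_W=T_I\mathcal{S}_W,\qquad T_W=\mathcal{S}_W^{-1}T_I\mathcal{S}_W$$ on $\Omega_{\rm BB}(H)$. In particular, $$r_{\Omega_{\rm BB}(H)}(T_W)=r_{\Omega_{\rm BB}(H)}(T_I).$$
   Context: Let $a:=\lambda_{\min}(H)>0$ and $b:=\lambda_{\max}(H)$ be the smallest and largest eigenvalues of $H$. A positive spectral weight is a matrix $W=\omega(H)$ (functional calculus), where $\omega$ is a real function on the spectrum $\sigma(H)$ with $\omega(\lambda)>0$ for every $\lambda\in\sigma(H)$; thus $W$ is symmetric positive definite and $WH=HW$. For $u\in\mathbb{R}^n\setminus\{0\}$ set $\alpha_W(u):=\dfrac{u^TWu}{u^TWHu}\in[b^{-1},a^{-1}]$. The compatible cone is $$\Omega_{\rm BB}(H):=\{(u,v)\in\mathbb{R}^n\times\mathbb{R}^n: v=(I-\alpha H)u\text{ for some }\alpha\in[b^{-1},a^{-1}]\}.$$ Its only element with $u=0$ is $(0,0)$. Define $T_W:\Omega_{\rm BB}(H)\to\Omega_{\rm BB}(H)$ by $T_W(u,v):=\bigl(v,(I-\alpha_W(u)H)v\bigr)$ if $u\ne 0$, and $T_W(0,0):=(0,0)$.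 The product norm is $\lVert(u,v)\rVert_\times:=(\lVert u\rVert^2+\lVert v\rVert^2)^{1/2}$ with $\lVert\cdot\rVert$ Euclidean. Growth radius: for a closed cone $\Omega\ne\{0\}$ in a finite-dimensional normed space (closed set containing $0$ and stable under multiplication by $t\ge0$) and a continuous self-map $T:\Omega\to\Omega$ with $T(tx)=tT(x)$ for $t\ge0$, set $a_k(T):=\max\{\lVert T^k(x)\rVert: x\in\Omega,\ \lVert x\rVert=1\}$ and $r_\Omega(T):=\lim_{k\to\infty}a_k(T)^{1/k}=\inf_{k\ge1}a_k(T)^{1/k}$ (the limit exists since $a_{k+\ell}(T)\le a_k(T)a_\ell(T)$). Here it is applied with $\Omega=\Omega_{\rm BB}(H)$ and norm $\lVert\cdot\rVert_\times$. *)

theory Defs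
  imports "HOL-Analysis.Analysis"
begin

definition sym_pos_def :: "real^'n^'n \<Rightarrow> bool" where
  "sym_pos_def H \<longleftrightarrow> transpose H = H \<and> (\<forall>x. x \<noteq> 0 \<longrightarrow> x \<bullet> (H *v x) > 0)"

definition eigenspace :: "real^'n^'n \<Rightarrow> real \<Rightarrow> (real^'n) set" where
  "eigenspace H l = {x. H *v x = l *\<^sub>R x}"

text \<open>Real eigenvalues only; for symmetric matrices this is the whole spectrum.\<close>

definition spectrum :: "real^'n^'n \<Rightarrow> real set" where
  "spectrum H = {l. \<exists>x. x \<noteq> 0 \<and> H *v x = l *\<^sub>R x}"

definition lambda_min :: "real^'n^'n \<Rightarrow> real" where
  "lambda_min H = Min (spectrum H)"

definition lambda_max :: "real^'n^'n \<Rightarrow> real" where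
  "lambda_max H = Max (spectrum H)"

text \<open>The nearest-point map onto a linear subspace is the (linear) orthogonal projection.\<close>

definition eigenprojection :: "real^'n^'n \<Rightarrow> real \<Rightarrow> real^'n^'n" where
  "eigenprojection H l = matrix (closest_point (eigenspace H l))"

text \<open>Functional calculus \<open>f(H) = \<Sum>\<^sub>\<lambda> f(\<lambda>) P\<^sub>\<lambda>\<close>, for symmetric \<open>H\<close>. Only the values
  of \<open>f\<close> on the spectrum matter.\<close>

definition matrix_fun :: "(real \<Rightarrow> real) \<Rightarrow> real^'n^'n \<Rightarrow> real^'n^'n" where
  "matrix_fun f H = (\<Sum>l\<in>spectrum H. f l *\<^sub>R eigenprojection H l)"

definition matrix_sqrt :: "real^'n^'n \<Rightarrow> real^'n^'n" where
  "matrix_sqrt W = matrix_fun sqrt W"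

definition BB_alpha :: "real^'n^'n \<Rightarrow> real^'n^'n \<Rightarrow> real^'n \<Rightarrow> real" where
  "BB_alpha H W u = (u \<bullet> (W *v u)) / (u \<bullet> ((W ** H) *v u))"

definition BB_cone :: "real^'n^'n \<Rightarrow> ((real^'n) \<times> (real^'n)) set" where
  "BB_cone H = {(u, v). \<exists>\<alpha>\<in>{inverse (lambda_max H)..inverse (lambda_min H)}.
                          v = (mat 1 - \<alpha> *\<^sub>R H) *v u}"

text \<open>The transition is a total function, of interest only on \<^term>\<open>BB_cone H\<close>, whose only
  element with \<open>u = 0\<close> is \<open>(0, 0)\<close>.\<close>

definition BB_transition ::
    "real^'n^'n \<Rightarrow> real^'n^'n \<Rightarrow> (real^'n) \<times> (real^'n) \<Rightarrow> (real^'n) \<times> (real^'n)" where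
  "BB_transition H W = (\<lambda>(u, v).
     if u = 0 then (0, 0) else (v, (mat 1 - BB_alpha H W u *\<^sub>R H) *v v))"

definition diag_action ::
    "real^'n^'n \<Rightarrow> (real^'n) \<times> (real^'n) \<Rightarrow> (real^'n) \<times> (real^'n)" where
  "diag_action S = (\<lambda>(u, v). (S *v u, S *v v))"

text \<open>The setting in which the growth radius is meaningful.\<close>

definition homogeneous_cone_map :: "'a::euclidean_space set \<Rightarrow> ('a \<Rightarrow> 'a) \<Rightarrow> bool" where
  "homogeneous_cone_map \<Omega> T \<longleftrightarrow>
     closed \<Omega> \<and> 0 \<in> \<Omega> \<and> cone \<Omega> \<and> \<Omega> \<noteq> {0} \<and>
     T \<in> \<Omega> \<rightarrow> \<Omega> \<and> continuous_on \<Omega> T \<and>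
     (\<forall>t\<ge>0. \<forall>x\<in>\<Omega>. T (t *\<^sub>R x) = t *\<^sub>R T x)"

text \<open>Under \<^const>\<open>homogeneous_cone_map\<close> the supremum is a maximum, see
  \<open>growth_coeff_attained\<close> below. On pairs, the library norm is
  \<open>sqrt ((norm u)\<^sup>2 + (norm v)\<^sup>2)\<close>.\<close>

definition growth_coeff :: "'a::euclidean_space set \<Rightarrow> ('a \<Rightarrow> 'a) \<Rightarrow> nat \<Rightarrow> real" where
  "growth_coeff \<Omega> T k = (SUP x\<in>{x \<in> \<Omega>. norm x = 1}. norm ((T ^^ k) x))"

definition growth_radius :: "'a::euclidean_space set \<Rightarrow> ('a \<Rightarrow> 'a) \<Rightarrow> real" where
  "growth_radius \<Omega> T = lim (\<lambda>k. root k (growth_coeff \<Omega> T k))"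

lemma growth_coeff_attained:
  assumes "homogeneous_cone_map \<Omega> T"
  shows "\<exists>x\<in>\<Omega>. norm x = 1 \<and> growth_coeff \<Omega> T k = norm ((T ^^ k) x) \<and>
           (\<forall>y\<in>\<Omega>. norm y = 1 \<longrightarrow> norm ((T ^^ k) y) \<le> norm ((T ^^ k) x))"
proof -
  let ?K = "{x \<in> \<Omega>. norm x = 1}"
  have cl: "closed \<Omega>" and co: "cone \<Omega>" and ne: "0 \<in> \<Omega>" "\<Omega> \<noteq> {0}"
    and self: "T \<in> \<Omega> \<rightarrow> \<Omega>" and cont: "continuous_on \<Omega> T"
    using assms by (auto simp: homogeneous_cone_map_def)
  have iter: "(T ^^ k) \<in> \<Omega> \<rightarrow> \<Omega> \<and> continuous_on \<Omega> (T ^^ k)" for k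
  proof (induction k)
    case (Suc k)
    have "continuous_on \<Omega> (T \<circ> (T ^^ k))"
      using Suc cont by (intro continuous_on_compose) (auto intro: continuous_on_subset)
    then show ?case using Suc self by auto
  qed auto
  have K: "?K = \<Omega> \<inter> sphere 0 1" by (auto simp: dist_norm)
  have cpt: "compact ?K" unfolding K by (rule closed_Int_compact[OF cl]) simp
  obtain z where z: "z \<in> \<Omega>" "z \<noteq> 0" using ne by blast
  have "inverse (norm z) *\<^sub>R z \<in> ?K"
    using z co by (simp add: cone_def)
  then have "?K \<noteq> {}" by blast
  moreover have "continuous_on ?K (\<lambda>x. norm ((T ^^ k) x))"
    using iter[of k] by (intro continuous_on_norm) (auto intro: continuous_on_subset)
  ultimately obtain x where x: "x \<in> ?K" "\<forall>y\<in>?K. norm ((T ^^ k) y) \<le> norm ((T ^^ k) x)"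
    using continuous_attains_sup[OF cpt] by blast
  then have "growth_coeff \<Omega> T k = norm ((T ^^ k) x)"
    unfolding growth_coeff_def by (intro cSup_eq_maximum) auto
  with x show ?thesis by blast
qed

end

theory Submission
  imports Defs
begin

text \<open>
  Write \<open>S = W\<^sup>1\<^sup>/\<^sup>2\<close>. Since \<open>S\<close> is symmetric and commutes with \<open>H\<close>, the weighted step size is
  \<open>u \<bullet> S\<^sup>2 u / (u \<bullet> S\<^sup>2 H u) = (S u \<bullet> S u) / (S u \<bullet> H (S u))\<close>, the BB1 step size at \<open>S u\<close>
  (\<open>BB_alpha_square_weight\<close>). Because \<open>S\<close> also commutes with each \<open>I - \<alpha> H\<close>, it maps the
  compatible cone to itself and intertwines the two transitions (\<open>diag_action_BB_transition\<close>).

  The facts about \<open>S\<close> come from functional calculus, which rests on the spectral theorem in the form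
  that the eigenvectors of a symmetric matrix span the space (\<open>span_eigenvectors\<close>): an identity
  between functions of \<open>H\<close> needs to be checked on eigenvectors only. In this way
  \<open>W\<^sup>1\<^sup>/\<^sup>2\<close>, formed from the spectral decomposition of \<open>W\<close>, is recognised as the function
  \<open>\<surd>\<omega>\<close> of \<open>H\<close> (\<open>matrix_sqrt_matrix_fun\<close>), with inverse \<open>(1/\<surd>\<omega>)(H)\<close>.

  That the BB1 transition is a continuous homogeneous self-map of the cone is proved directly
  (\<open>homogeneous_cone_map_BB1\<close>); the Rayleigh bounds on the step size give both invariance of the cone
  and continuity at its apex. Conjugation by the linear bijection \<open>S\<close> carries this over to \<open>W\<close>
  (\<open>homogeneous_cone_map_linear_conjugate\<close>). Finally \<open>T\<^sub>W\<^sup>k = S\<^sup>-\<^sup>1 T\<^sub>I\<^sup>k S\<close>, so the growth coefficients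
  of the two maps agree up to factors that do not depend on \<open>k\<close>, and these factors vanish under
  \<open>k\<close>-th roots (\<open>growth_radius_conjugate\<close>).
\<close>

section \<open>Eigenvectors of a symmetric matrix\<close>

lemma symmetric_matrix_inner:
  fixes A :: "real^'n^'n"
  assumes "transpose A = A"
  shows "(A *v x) \<bullet> y = x \<bullet> (A *v y)"
  by (metis assms dot_lmul_matrix transpose_matrix_vector)

lemma symmetric_matrixI:
  fixes A :: "real^'n^'n"
  assumes "\<And>x y. (A *v x) \<bullet> y = x \<bullet> (A *v y)"
  shows "transpose A = A"
proof -
  have "(transpose A *v x) \<bullet> y = (A *v x) \<bullet> y" for x y
    using assms by (simp add: dot_lmul_matrix)
  then have "transpose A *v x = A *v x" for x
    by (metis vector_eq_rdot)
  then show ?thesis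
    by (simp add: matrix_eq)
qed

lemma continuous_on_matrix_vector_mult [continuous_intros]:
  fixes A :: "real^'n^'m"
  shows "continuous_on X f \<Longrightarrow> continuous_on X (\<lambda>x. A *v f x)"
  by (rule bounded_linear.continuous_on[OF matrix_vector_mul_bounded_linear])

lemma subspace_eigenspace: "subspace (eigenspace H l)"
  by (auto simp: subspace_def eigenspace_def matrix_vector_right_distrib
      matrix_vector_mult_scaleR scaleR_add_right)

lemma eigenspace_orthogonal:
  fixes H :: "real^'n^'n"
  assumes sym: "transpose H = H" and "x \<in> eigenspace H l" "y \<in> eigenspace H m" "l \<noteq> m"
  shows "x \<bullet> y = 0"
proof -
  have "l * (x \<bullet> y) = m * (x \<bullet> y)"
    using assms symmetric_matrix_inner[OF sym, of x y] by (simp add: eigenspace_def)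
  with \<open>l \<noteq> m\<close> show ?thesis by simp
qed

lemma finite_spectrum:
  fixes H :: "real^'n^'n"
  assumes sym: "transpose H = H"
  shows "finite (spectrum H)"
proof -
  define e where "e l = (SOME x. x \<noteq> 0 \<and> H *v x = l *\<^sub>R x)" for l
  have e: "e l \<noteq> 0" "e l \<in> eigenspace H l" if "l \<in> spectrum H" for l
    using that someI_ex[of "\<lambda>x. x \<noteq> 0 \<and> H *v x = l *\<^sub>R x"]
    by (auto simp: e_def spectrum_def eigenspace_def)
  have orth: "e l \<bullet> e m = 0" if "l \<in> spectrum H" "m \<in> spectrum H" "l \<noteq> m" for l m
    using eigenspace_orthogonal[OF sym] e that by blast
  have inj: "inj_on e (spectrum H)"
    by (rule inj_onI, rule ccontr) (use orth e in fastforce)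
  have "pairwise orthogonal (e ` spectrum H)"
    using orth by (auto simp: pairwise_def orthogonal_def)
  moreover have "0 \<notin> e ` spectrum H"
    using e by fastforce
  ultimately have "independent (e ` spectrum H)"
    by (rule pairwise_orthogonal_independent)
  then have "finite (e ` spectrum H)"
    by (rule independent_imp_finite)
  with inj show ?thesis
    by (simp add: finite_image_iff)
qed

text \<open>The eigenvector is a maximiser \<open>x\<close> of the Rayleigh quotient on the invariant subspace \<open>V\<close>,
  and the eigenvalue \<open>l\<close> is the maximum: the quadratic form \<open>q y = l \<bar>y\<bar>\<^sup>2 - y \<bullet> H y\<close> is nonnegative
  on \<open>V\<close> and vanishes at \<open>x\<close>, so its first variation at \<open>x\<close> in the directions of \<open>V\<close> is zero.\<close>

lemma rayleigh_maximum_eigenvalue: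
  fixes H :: "real^'n^'n"
  assumes sym: "transpose H = H" and V: "subspace V" "V \<noteq> {0}"
    and inv: "\<And>x. x \<in> V \<Longrightarrow> H *v x \<in> V"
  obtains l x where "x \<in> V" "x \<noteq> 0" "H *v x = l *\<^sub>R x"
    "\<And>y. y \<in> V \<Longrightarrow> y \<bullet> (H *v y) \<le> l * (y \<bullet> y)"
proof -
  let ?K = "V \<inter> sphere 0 1"
  have "compact ?K"
    by (intro closed_Int_compact closed_subspace V compact_sphere)
  moreover have "?K \<noteq> {}"
  proof -
    obtain z where z: "z \<in> V" "z \<noteq> 0"
      using V subspace_0 by blast
    then have "inverse (norm z) *\<^sub>R z \<in> ?K"
      using V by (simp add: subspace_scale)
    then show ?thesis by blast
  qed
  moreover have "continuous_on ?K (\<lambda>y. y \<bullet> (H *v y))"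
    by (intro continuous_intros)
  ultimately obtain x where x: "x \<in> ?K" and max: "\<And>y. y \<in> ?K \<Longrightarrow> y \<bullet> (H *v y) \<le> x \<bullet> (H *v x)"
    using continuous_attains_sup[of ?K "\<lambda>y. y \<bullet> (H *v y)"] by blast
  define l where "l = x \<bullet> (H *v x)"
  have xV: "x \<in> V" and xx: "x \<bullet> x = 1" "x \<noteq> 0"
    using x by (auto simp: norm_eq_1)
  have le: "y \<bullet> (H *v y) \<le> l * (y \<bullet> y)" if "y \<in> V" for y
  proof (cases "y = 0")
    case False
    then have "inverse (norm y) *\<^sub>R y \<in> ?K"
      using that V by (simp add: subspace_scale)
    from max[OF this] have "inverse (norm y) * (inverse (norm y) * (y \<bullet> (H *v y))) \<le> l"
      by (simp add: matrix_vector_mult_scaleR l_def)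
    then have "(y \<bullet> (H *v y)) / (norm y)\<^sup>2 \<le> l"
      by (simp add: power2_eq_square field_simps)
    then show ?thesis
      using False by (simp add: divide_le_eq power2_norm_eq_inner)
  qed simp
  define w where "w = l *\<^sub>R x - H *v x"
  have wV: "w \<in> V"
    unfolding w_def by (intro subspace_diff subspace_scale V xV inv)
  \<comment> \<open>\<open>w\<close> is half the gradient of \<open>q\<close> at \<open>x\<close>; moving from \<open>x\<close> along \<open>- w\<close> would make \<open>q\<close>
    negative unless \<open>w = 0\<close>.\<close>
  define qw where "qw = l * (w \<bullet> w) - w \<bullet> (H *v w)"
  have quad: "0 \<le> - 2 * t * (w \<bullet> w) + t\<^sup>2 * qw" for t
  proof -
    have "x - t *\<^sub>R w \<in> V"
      by (intro subspace_diff subspace_scale V xV wV)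
    from le[OF this] have "0 \<le> l * ((x - t *\<^sub>R w) \<bullet> (x - t *\<^sub>R w))
        - (x - t *\<^sub>R w) \<bullet> (H *v (x - t *\<^sub>R w))"
      by simp
    also have "\<dots> = l * (x \<bullet> x) - x \<bullet> (H *v x) - 2 * t * (l * (x \<bullet> w) - (H *v x) \<bullet> w) + t\<^sup>2 * qw"
    proof -
      have "x \<bullet> (H *v w) = (H *v x) \<bullet> w" "w \<bullet> (H *v x) = (H *v x) \<bullet> w" "w \<bullet> x = x \<bullet> w"
        using symmetric_matrix_inner[OF sym, of x w] by (simp_all add: inner_commute)
      then show ?thesis
        by (simp add: qw_def matrix_vector_mult_diff_distrib matrix_vector_mult_scaleR
            inner_diff_left inner_diff_right ring_distribs power2_eq_square)
    qed
    also have "l * (x \<bullet> w) - (H *v x) \<bullet> w = w \<bullet> w"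
      by (simp add: w_def inner_diff_left)
    finally show ?thesis
      using xx by (simp add: l_def)
  qed
  have "w \<bullet> w = 0"
  proof (rule ccontr)
    assume "w \<bullet> w \<noteq> 0"
    then have pos: "w \<bullet> w > 0"
      using inner_ge_zero[of w] by linarith
    \<comment> \<open>The denominator makes \<open>t qw \<le> w \<bullet> w\<close>, so that the linear term of \<open>quad\<close> dominates.\<close>
    define t where "t = (w \<bullet> w) / (\<bar>qw\<bar> + 1)"
    have t: "t > 0" "t * (\<bar>qw\<bar> + 1) = w \<bullet> w"
      using pos by (auto simp: t_def)
    have "t * qw \<le> t * (\<bar>qw\<bar> + 1)"
      using t by (intro mult_left_mono) auto
    then have "t * qw - 2 * (w \<bullet> w) < 0"
      using t pos by linarith
    then have "t * (t * qw - 2 * (w \<bullet> w)) < 0"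
      using t by (intro mult_pos_neg)
    with quad[of t] show False
      by (simp add: algebra_simps power2_eq_square)
  qed
  then have "H *v x = l *\<^sub>R x"
    by (simp add: w_def)
  with xV xx le show thesis
    using that by blast
qed

text \<open>The orthogonal complement of the span of all eigenvectors is invariant as well. It holds no
  eigenvector, so the Rayleigh argument forces it to be zero.\<close>

lemma span_eigenvectors:
  fixes H :: "real^'n^'n"
  assumes sym: "transpose H = H"
  shows "span (\<Union>l. eigenspace H l) = UNIV"
proof -
  let ?E = "\<Union>l. eigenspace H l"
  define V where "V = {x. \<forall>y\<in>?E. x \<bullet> y = 0}"
  have V: "subspace V"
    by (auto simp: V_def subspace_def inner_add_left)
  have inv: "H *v x \<in> V" if "x \<in> V" for x
    using that by (auto simp: V_def symmetric_matrix_inner[OF sym] eigenspace_def)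
  have "V = {0}"
  proof (rule ccontr)
    assume "V \<noteq> {0}"
    then obtain l x where x: "x \<in> V" "x \<noteq> 0" "H *v x = l *\<^sub>R x"
      using rayleigh_maximum_eigenvalue[OF sym V _ inv] by metis
    then have "x \<in> ?E" by (auto simp: eigenspace_def)
    with x have "x \<bullet> x = 0" unfolding V_def by blast
    with x show False by simp
  qed
  show ?thesis
  proof (rule ccontr)
    assume "span ?E \<noteq> UNIV"
    then have "dim ?E < DIM(real^'n)"
      by (metis dim_eq_full dim_subset_UNIV le_neq_implies_less)
    then obtain x where "x \<noteq> 0" "\<And>y. y \<in> span ?E \<Longrightarrow> orthogonal x y"
      using orthogonal_to_subspace_exists by blast
    then have "x \<in> V" by (auto simp: V_def orthogonal_def intro!: span_base)
    with \<open>V = {0}\<close> \<open>x \<noteq> 0\<close> show False by blast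
  qed
qed

lemma matrix_eqI_eigenvectors:
  fixes H A B :: "real^'n^'n"
  assumes "transpose H = H"
    and eq: "\<And>l x. x \<in> eigenspace H l \<Longrightarrow> A *v x = B *v x"
  shows "A = B"
proof -
  have "A *v x = B *v x" for x
  proof (rule linear_eq_on[of "(*v) A" "(*v) B" x "\<Union>l. eigenspace H l"])
    show "x \<in> span (\<Union>l. eigenspace H l)"
      by (simp add: span_eigenvectors[OF assms(1)])
    show "A *v y = B *v y" if "y \<in> (\<Union>l. eigenspace H l)" for y
      using that eq by blast
  qed simp_all
  then show ?thesis by (simp add: matrix_eq)
qed

lemma rayleigh_upper:
  fixes H :: "real^'n^'n"
  assumes sym: "transpose H = H"
  obtains l where "l \<in> spectrum H" "\<And>y. y \<bullet> (H *v y) \<le> l * (y \<bullet> y)"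
proof -
  have "(UNIV :: (real^'n) set) \<noteq> {0}"
    by (metis UNIV_I axis_eq_0_iff singletonD zero_neq_one)
  then show thesis
    using rayleigh_maximum_eigenvalue[OF sym subspace_UNIV] that
    by (smt (verit, best) UNIV_I mem_Collect_eq spectrum_def)
qed

lemma rayleigh_le_lambda_max:
  fixes H :: "real^'n^'n"
  assumes sym: "transpose H = H"
  shows "y \<bullet> (H *v y) \<le> lambda_max H * (y \<bullet> y)"
proof -
  obtain l where l: "l \<in> spectrum H" "y \<bullet> (H *v y) \<le> l * (y \<bullet> y)"
    using rayleigh_upper[OF sym] by metis
  have "l \<le> lambda_max H"
    unfolding lambda_max_def using l finite_spectrum[OF sym] by simp
  with l show ?thesis
    by (meson inner_ge_zero mult_right_mono order_trans)
qed

lemma rayleigh_ge_lambda_min: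
  fixes H :: "real^'n^'n"
  assumes sym: "transpose H = H"
  shows "lambda_min H * (y \<bullet> y) \<le> y \<bullet> (H *v y)"
proof -
  have neg: "(- H) *v x = - (H *v x)" for x
    using matrix_vector_mult_diff_rdistrib[of 0 H x] by simp
  have "transpose (- H) = - H"
    by (rule symmetric_matrixI) (simp add: neg symmetric_matrix_inner[OF sym])
  then obtain l where l: "l \<in> spectrum (- H)" "y \<bullet> ((- H) *v y) \<le> l * (y \<bullet> y)"
    using rayleigh_upper by metis
  have "- l \<in> spectrum H"
    using l(1) by (auto simp: spectrum_def neg) (metis minus_equation_iff scaleR_minus_left)
  then have "lambda_min H \<le> - l"
    unfolding lambda_min_def using finite_spectrum[OF sym] by simp
  then have "lambda_min H * (y \<bullet> y) \<le> - l * (y \<bullet> y)"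
    by (intro mult_right_mono) auto
  with l(2) show ?thesis
    by (simp add: neg)
qed

lemma spectrum_nonempty:
  fixes H :: "real^'n^'n"
  assumes "transpose H = H"
  shows "spectrum H \<noteq> {}"
  by (rule rayleigh_upper[OF assms]) auto

lemma lambda_min_pos:
  fixes H :: "real^'n^'n"
  assumes "sym_pos_def H"
  shows "0 < lambda_min H"
proof -
  have sym: "transpose H = H" using assms by (simp add: sym_pos_def_def)
  have "lambda_min H \<in> spectrum H"
    unfolding lambda_min_def using finite_spectrum[OF sym] spectrum_nonempty[OF sym] by simp
  then obtain x where x: "x \<noteq> 0" "H *v x = lambda_min H *\<^sub>R x"
    by (auto simp: spectrum_def)
  then have "0 < lambda_min H * (x \<bullet> x)"
    using assms by (metis inner_scaleR_right sym_pos_def_def)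
  then show ?thesis
    by (rule zero_less_mult_pos2) (simp add: x)
qed

section \<open>Functional calculus\<close>

lemma closest_point_subspace_orthogonal:
  fixes V :: "'a::euclidean_space set"
  assumes V: "subspace V" and "p \<in> V" and orth: "\<And>y. y \<in> V \<Longrightarrow> (x - p) \<bullet> y = 0"
  shows "closest_point V x = p"
proof -
  have "dist x p \<le> dist x z" if "z \<in> V" for z
  proof -
    have "orthogonal (x - p) (p - z)"
      using orth[of "p - z"] that \<open>p \<in> V\<close> V by (simp add: orthogonal_def subspace_diff)
    then have "(norm (x - z))\<^sup>2 = (norm (x - p))\<^sup>2 + (norm (p - z))\<^sup>2"
      using norm_add_Pythagorean[of "x - p" "p - z"] by simp
    then have "(norm (x - p))\<^sup>2 \<le> (norm (x - z))\<^sup>2" by simp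
    then show ?thesis
      by (simp add: dist_norm)
  qed
  then show ?thesis
    using closest_point_unique[of V p x] closed_subspace[OF V] subspace_imp_convex[OF V] \<open>p \<in> V\<close>
    by simp
qed

lemma closest_point_subspace:
  fixes V :: "'a::euclidean_space set"
  assumes V: "subspace V"
  shows "closest_point V x \<in> V" and "y \<in> V \<Longrightarrow> (x - closest_point V x) \<bullet> y = 0"
proof -
  obtain p q where pq: "p \<in> span V" "\<And>w. w \<in> span V \<Longrightarrow> orthogonal q w" "x = p + q"
    using orthogonal_subspace_decomp_exists[of V x] by metis
  have [simp]: "span V = V" using V by (simp add: span_eq_iff)
  have "closest_point V x = p"
    using pq by (intro closest_point_subspace_orthogonal V) (auto simp: orthogonal_def)
  then show "closest_point V x \<in> V" "y \<in> V \<Longrightarrow> (x - closest_point V x) \<bullet> y = 0"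
    using pq by (auto simp: orthogonal_def)
qed

lemma linear_closest_point_subspace:
  fixes V :: "'a::euclidean_space set"
  assumes V: "subspace V"
  shows "linear (closest_point V)"
proof (rule linearI)
  note mem = closest_point_subspace(1)[OF V] and orth = closest_point_subspace(2)[OF V]
  show "closest_point V (x + y) = closest_point V x + closest_point V y" for x y
  proof (rule closest_point_subspace_orthogonal[OF V])
    show "closest_point V x + closest_point V y \<in> V"
      by (intro subspace_add V mem)
    show "(x + y - (closest_point V x + closest_point V y)) \<bullet> z = 0" if "z \<in> V" for z
      using orth[OF that, of x] orth[OF that, of y] by (simp add: inner_diff_left inner_add_left)
  qed
  show "closest_point V (c *\<^sub>R x) = c *\<^sub>R closest_point V x" for c x
  proof (rule closest_point_subspace_orthogonal[OF V])
    show "c *\<^sub>R closest_point V x \<in> V"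
      by (intro subspace_scale V mem)
    show "(c *\<^sub>R x - c *\<^sub>R closest_point V x) \<bullet> z = 0" if "z \<in> V" for z
      using orth[OF that, of x] by (simp add: inner_diff_left)
  qed
qed

lemma eigenprojection_apply: "eigenprojection H l *v x = closest_point (eigenspace H l) x"
  unfolding eigenprojection_def
  by (rule matrix_works)
    (simp add: linear_matrix_vector_mul_eq linear_closest_point_subspace subspace_eigenspace)

lemma eigenprojection_symmetric:
  "(eigenprojection H l *v x) \<bullet> y = x \<bullet> (eigenprojection H l *v y)"
proof -
  let ?P = "closest_point (eigenspace H l)"
  note proj = closest_point_subspace[OF subspace_eigenspace[of H l]]
  have "?P x \<bullet> y = ?P x \<bullet> ?P y"
    using proj(2)[OF proj(1), of y x]
    by (simp add: inner_diff_left inner_commute[of "?P x"])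
  moreover have "x \<bullet> ?P y = ?P x \<bullet> ?P y"
    using proj(2)[OF proj(1), of x y] by (simp add: inner_diff_left)
  ultimately show ?thesis
    by (simp add: eigenprojection_apply)
qed

lemma eigenprojection_eigenvector:
  fixes H :: "real^'n^'n"
  assumes "transpose H = H" and "x \<in> eigenspace H l"
  shows "eigenprojection H m *v x = (if m = l then x else 0)"
proof -
  let ?p = "if m = l then x else 0"
  have "?p \<in> eigenspace H m"
    using assms(2) subspace_0[OF subspace_eigenspace[of H m]] by simp
  moreover have "(x - ?p) \<bullet> y = 0" if "y \<in> eigenspace H m" for y
    using eigenspace_orthogonal[OF assms that] by simp
  ultimately show ?thesis
    unfolding eigenprojection_apply
    by (rule closest_point_subspace_orthogonal[OF subspace_eigenspace])
qed

lemma matrix_fun_apply: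
  "matrix_fun f H *v x = (\<Sum>l\<in>spectrum H. f l *\<^sub>R (eigenprojection H l *v x))"
proof -
  have "(\<Sum>l\<in>I. A l) *v x = (\<Sum>l\<in>I. A l *v x)" for I :: "real set" and A :: "real \<Rightarrow> real^'a^'a"
    by (induction I rule: infinite_finite_induct) (auto simp: matrix_vector_mult_add_rdistrib)
  then show ?thesis
    by (simp add: matrix_fun_def scaleR_matrix_vector_assoc)
qed

lemma transpose_matrix_fun: "transpose (matrix_fun f H) = matrix_fun f H"
proof (rule symmetric_matrixI)
  show "(matrix_fun f H *v x) \<bullet> y = x \<bullet> (matrix_fun f H *v y)" for x y
    by (simp add: matrix_fun_apply inner_sum_left inner_sum_right eigenprojection_symmetric)
qed

lemma matrix_fun_eigenvector:
  fixes H :: "real^'n^'n"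
  assumes sym: "transpose H = H" and x: "x \<in> eigenspace H l"
  shows "matrix_fun f H *v x = f l *\<^sub>R x"
proof (cases "x = 0")
  case False
  then have l: "l \<in> spectrum H" using x by (auto simp: spectrum_def eigenspace_def)
  have "matrix_fun f H *v x = (\<Sum>m\<in>spectrum H. if m = l then f l *\<^sub>R x else 0)"
    unfolding matrix_fun_apply
    by (rule sum.cong) (auto simp: eigenprojection_eigenvector[OF sym x])
  with l finite_spectrum[OF sym] show ?thesis by simp
qed simp

lemma matrix_fun_mult:
  fixes H :: "real^'n^'n"
  assumes sym: "transpose H = H"
  shows "matrix_fun f H ** matrix_fun g H = matrix_fun (\<lambda>l. f l * g l) H"
proof (rule matrix_eqI_eigenvectors[OF sym])
  fix l x assume "x \<in> eigenspace H l"
  note eig = matrix_fun_eigenvector[OF sym this]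
  have "(matrix_fun f H ** matrix_fun g H) *v x = matrix_fun f H *v (matrix_fun g H *v x)"
    by (rule matrix_vector_mul_assoc[symmetric])
  then show "(matrix_fun f H ** matrix_fun g H) *v x = matrix_fun (\<lambda>l. f l * g l) H *v x"
    by (simp add: eig matrix_vector_mult_scaleR mult.commute)
qed

lemma matrix_fun_cong:
  assumes "\<And>l. l \<in> spectrum H \<Longrightarrow> f l = g l"
  shows "matrix_fun f H = matrix_fun g H"
  unfolding matrix_fun_def using assms by (intro sum.cong) auto

lemma matrix_fun_one:
  fixes H :: "real^'n^'n"
  assumes sym: "transpose H = H"
  shows "matrix_fun (\<lambda>l. 1) H = mat 1"
proof (rule matrix_eqI_eigenvectors[OF sym])
  fix l x assume "x \<in> eigenspace H l"
  from matrix_fun_eigenvector[OF sym this] show "matrix_fun (\<lambda>l. 1) H *v x = mat 1 *v x"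
    by simp
qed

lemma matrix_fun_commute:
  fixes H :: "real^'n^'n"
  assumes sym: "transpose H = H"
  shows "matrix_fun f H ** H = H ** matrix_fun f H"
proof (rule matrix_eqI_eigenvectors[OF sym])
  fix l x assume x: "x \<in> eigenspace H l"
  then have "H *v x = l *\<^sub>R x" by (simp add: eigenspace_def)
  with matrix_fun_eigenvector[OF sym x]
  have "matrix_fun f H *v (H *v x) = H *v (matrix_fun f H *v x)"
    by (simp add: matrix_vector_mult_scaleR mult.commute)
  then show "(matrix_fun f H ** H) *v x = (H ** matrix_fun f H) *v x"
    by (simp only: matrix_vector_mul_assoc)
qed

text \<open>Eigenvectors of \<open>H\<close> are eigenvectors of \<open>f(H)\<close>, which settles the composition rule on a
  spanning set, even if \<open>f\<close> merges several eigenspaces of \<open>H\<close> into one.\<close>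

lemma matrix_sqrt_matrix_fun:
  fixes H :: "real^'n^'n"
  assumes sym: "transpose H = H"
  shows "matrix_sqrt (matrix_fun f H) = matrix_fun (\<lambda>l. sqrt (f l)) H"
proof (rule matrix_eqI_eigenvectors[OF sym])
  fix l x assume x: "x \<in> eigenspace H l"
  then have "x \<in> eigenspace (matrix_fun f H) (f l)"
    using matrix_fun_eigenvector[OF sym x] by (simp add: eigenspace_def)
  from matrix_fun_eigenvector[OF transpose_matrix_fun this]
  show "matrix_sqrt (matrix_fun f H) *v x = matrix_fun (\<lambda>l. sqrt (f l)) H *v x"
    by (simp add: matrix_sqrt_def matrix_fun_eigenvector[OF sym x])
qed

section \<open>Linear conjugation of homogeneous cone maps\<close>

text \<open>This carries the cone-map property from the BB1 transition to every weight, including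
  continuity at the apex.\<close>

lemma homogeneous_cone_map_linear_conjugate:
  fixes F G :: "'a::euclidean_space \<Rightarrow> 'a"
  assumes T: "homogeneous_cone_map \<Omega> T"
    and F: "linear F" "F \<in> \<Omega> \<rightarrow> \<Omega>" and G: "linear G" "G \<in> \<Omega> \<rightarrow> \<Omega>"
    and T': "\<And>p. p \<in> \<Omega> \<Longrightarrow> T' p = G (T (F p))"
  shows "homogeneous_cone_map \<Omega> T'"
proof -
  have cont: "continuous_on A F" "continuous_on A G" for A
    using F G by (auto intro: linear_continuous_on simp: linear_conv_bounded_linear)
  have TT: "T \<in> \<Omega> \<rightarrow> \<Omega>" "continuous_on \<Omega> T" "cone \<Omega>"
    and hom: "\<And>t x. t \<ge> 0 \<Longrightarrow> x \<in> \<Omega> \<Longrightarrow> T (t *\<^sub>R x) = t *\<^sub>R T x"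
    using T by (auto simp: homogeneous_cone_map_def)
  have "continuous_on \<Omega> (\<lambda>p. G (T (F p)))"
    by (rule continuous_on_compose2[OF cont(2) continuous_on_compose2[OF TT(2) cont(1)]])
      (use F in auto)
  then have "continuous_on \<Omega> T'"
    using T' by (simp cong: continuous_on_cong)
  moreover have "T' \<in> \<Omega> \<rightarrow> \<Omega>"
    using T' F G TT by (auto simp: Pi_iff)
  moreover have "T' (t *\<^sub>R x) = t *\<^sub>R T' x" if "t \<ge> 0" "x \<in> \<Omega>" for t x
  proof -
    have "t *\<^sub>R x \<in> \<Omega>" "F x \<in> \<Omega>" using that TT F by (auto simp: cone_def)
    with that show ?thesis
      by (simp add: T' hom linear_scale[OF F(1)] linear_scale[OF G(1)])
  qed
  ultimately show ?thesis
    using T by (auto simp: homogeneous_cone_map_def)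
qed

lemma homogeneous_cone_map_funpow:
  assumes "homogeneous_cone_map \<Omega> T" "x \<in> \<Omega>"
  shows "(T ^^ k) x \<in> \<Omega>" and "t \<ge> 0 \<Longrightarrow> (T ^^ k) (t *\<^sub>R x) = t *\<^sub>R (T ^^ k) x"
proof -
  have mem: "(T ^^ k) x \<in> \<Omega>" for k
    using assms by (induction k) (auto simp: homogeneous_cone_map_def)
  then show "(T ^^ k) x \<in> \<Omega>" .
  show "(T ^^ k) (t *\<^sub>R x) = t *\<^sub>R (T ^^ k) x" if "t \<ge> 0"
    using assms(1) that mem by (induction k) (auto simp: homogeneous_cone_map_def)
qed

lemma norm_funpow_le_growth_coeff:
  assumes T: "homogeneous_cone_map \<Omega> T" and x: "x \<in> \<Omega>"
  shows "norm ((T ^^ k) x) \<le> growth_coeff \<Omega> T k * norm x"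
proof (cases "x = 0")
  case True
  then have "(T ^^ k) x = 0"
    using homogeneous_cone_map_funpow(2)[OF T x, of 0 k] by simp
  with True show ?thesis by simp
next
  case False
  let ?y = "inverse (norm x) *\<^sub>R x"
  have "?y \<in> \<Omega>" using T x by (auto simp: homogeneous_cone_map_def cone_def)
  moreover have "norm ?y = 1" using False by simp
  ultimately have "norm ((T ^^ k) ?y) \<le> growth_coeff \<Omega> T k"
    using growth_coeff_attained[OF T] by metis
  moreover have "(T ^^ k) ?y = inverse (norm x) *\<^sub>R (T ^^ k) x"
    by (rule homogeneous_cone_map_funpow(2)[OF T x]) simp
  ultimately show ?thesis
    using False by (simp add: field_simps)
qed

text \<open>Since \<open>T'\<^sup>k = G T\<^sup>k F\<close> on \<open>\<Omega>\<close>, conjugation costs the product of operator bounds of \<open>F\<close> and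
  \<open>G\<close> once, whatever the number of iterations.\<close>

lemma growth_coeff_conjugate_le:
  fixes F G :: "'a::euclidean_space \<Rightarrow> 'a"
  assumes T: "homogeneous_cone_map \<Omega> T" and T': "homogeneous_cone_map \<Omega> T'"
    and F: "linear F" "F \<in> \<Omega> \<rightarrow> \<Omega>" and G: "linear G"
    and GF: "\<And>p. p \<in> \<Omega> \<Longrightarrow> G (F p) = p"
    and conj: "\<And>p. p \<in> \<Omega> \<Longrightarrow> F (T' p) = T (F p)"
  obtains C where "C > 0" "\<And>k. growth_coeff \<Omega> T' k \<le> C * growth_coeff \<Omega> T k"
proof -
  obtain CF where CF: "CF > 0" "\<And>x. norm (F x) \<le> CF * norm x"
    using linear_bounded_pos[OF F(1)] by blast
  obtain CG where CG: "CG > 0" "\<And>x. norm (G x) \<le> CG * norm x"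
    using linear_bounded_pos[OF G] by blast
  have "growth_coeff \<Omega> T' k \<le> (CG * CF) * growth_coeff \<Omega> T k" for k
  proof -
    obtain x where x: "x \<in> \<Omega>" "norm x = 1" "growth_coeff \<Omega> T' k = norm ((T' ^^ k) x)"
      using growth_coeff_attained[OF T'] by metis
    have "F ((T' ^^ j) x) = (T ^^ j) (F x)" for j
      by (induction j) (simp_all add: conj homogeneous_cone_map_funpow(1)[OF T' x(1)])
    then have "(T' ^^ k) x = G ((T ^^ k) (F x))"
      by (metis GF homogeneous_cone_map_funpow(1)[OF T' x(1)])
    then have "growth_coeff \<Omega> T' k \<le> CG * norm ((T ^^ k) (F x))"
      using CG x by simp
    also have "\<dots> \<le> CG * (growth_coeff \<Omega> T k * norm (F x))"
      using F x CG by (intro mult_left_mono norm_funpow_le_growth_coeff T) auto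
    also have "\<dots> \<le> CG * (growth_coeff \<Omega> T k * CF)"
    proof -
      have "0 \<le> growth_coeff \<Omega> T k"
        using growth_coeff_attained[OF T] by (metis norm_ge_zero)
      then show ?thesis
        using CF(2)[of x] CG x by (intro mult_left_mono) auto
    qed
    finally show ?thesis by (simp add: mult_ac)
  qed
  then show thesis
    using that[of "CG * CF"] CF CG by simp
qed

text \<open>Constant factors disappear under \<open>k\<close>-th roots, so two comparable sequences have the same
  \<open>k\<close>-th root limits.\<close>

lemma tendsto_root_comparable:
  fixes a b :: "nat \<Rightarrow> real"
  assumes "C > 0" "D > 0" and ab: "\<And>k. a k \<le> C * b k" and ba: "\<And>k. b k \<le> D * a k"
    and lim: "(\<lambda>k. root k (b k)) \<longlonglongrightarrow> L"
  shows "(\<lambda>k. root k (a k)) \<longlonglongrightarrow> L"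
proof (rule tendsto_sandwich)
  have "inverse D * b k \<le> a k" for k
    using ba[of k] \<open>D > 0\<close> by (simp add: field_simps)
  then show "\<forall>\<^sub>F k in sequentially. root k (inverse D) * root k (b k) \<le> root k (a k)"
    by (auto intro!: eventually_sequentiallyI[of 1] simp flip: real_root_mult)
  show "\<forall>\<^sub>F k in sequentially. root k (a k) \<le> root k C * root k (b k)"
    using ab by (auto intro!: eventually_sequentiallyI[of 1] simp flip: real_root_mult)
  show "(\<lambda>k. root k (inverse D) * root k (b k)) \<longlonglongrightarrow> L"
    using tendsto_mult[OF LIMSEQ_root_const[of "inverse D"] lim] \<open>D > 0\<close> by simp
  show "(\<lambda>k. root k C * root k (b k)) \<longlonglongrightarrow> L"
    using tendsto_mult[OF LIMSEQ_root_const[of C] lim] \<open>C > 0\<close> by simp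
qed

text \<open>Each limit of one sequence of roots is a limit of the other, so \<^const>\<open>lim\<close> selects the same
  value for both.\<close>

lemma growth_radius_conjugate:
  fixes F G :: "'a::euclidean_space \<Rightarrow> 'a"
  assumes T: "homogeneous_cone_map \<Omega> T" and T': "homogeneous_cone_map \<Omega> T'"
    and F: "linear F" "F \<in> \<Omega> \<rightarrow> \<Omega>" and G: "linear G" "G \<in> \<Omega> \<rightarrow> \<Omega>"
    and GF: "\<And>p. p \<in> \<Omega> \<Longrightarrow> G (F p) = p" and FG: "\<And>p. p \<in> \<Omega> \<Longrightarrow> F (G p) = p"
    and conj: "\<And>p. p \<in> \<Omega> \<Longrightarrow> F (T' p) = T (F p)"
  shows "growth_radius \<Omega> T' = growth_radius \<Omega> T"
proof -
  have conj': "G (T p) = T' (G p)" if "p \<in> \<Omega>" for p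
  proof -
    have "G p \<in> \<Omega>" "T' (G p) \<in> \<Omega>"
      using that G T' by (auto simp: homogeneous_cone_map_def Pi_iff)
    then show ?thesis using conj[of "G p"] GF FG that by metis
  qed
  obtain C where C: "C > 0" "\<And>k. growth_coeff \<Omega> T' k \<le> C * growth_coeff \<Omega> T k"
    using growth_coeff_conjugate_le[OF T T' F G(1) GF conj] by metis
  obtain D where D: "D > 0" "\<And>k. growth_coeff \<Omega> T k \<le> D * growth_coeff \<Omega> T' k"
    using growth_coeff_conjugate_le[OF T' T G F(1) FG conj'] by metis
  have "((\<lambda>k. root k (growth_coeff \<Omega> T' k)) \<longlonglongrightarrow> L) \<longleftrightarrow>
      ((\<lambda>k. root k (growth_coeff \<Omega> T k)) \<longlonglongrightarrow> L)" for L
    using tendsto_root_comparable[where a = "growth_coeff \<Omega> T'" and b = "growth_coeff \<Omega> T",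
        OF C(1) D(1) C(2) D(2)]
      tendsto_root_comparable[where a = "growth_coeff \<Omega> T" and b = "growth_coeff \<Omega> T'",
        OF D(1) C(1) D(2) C(2)] by blast
  then show ?thesis
    by (simp add: growth_radius_def lim_def)
qed

section \<open>The BB1 transition\<close>

lemma shifted_matrix_apply:
  fixes H :: "real^'n^'n"
  shows "(mat 1 - c *\<^sub>R H) *v x = x - c *\<^sub>R (H *v x)"
  by (simp add: matrix_vector_mult_diff_rdistrib scaleR_matrix_vector_assoc)

lemma BB_alpha_bounds:
  fixes H :: "real^'n^'n"
  assumes H: "sym_pos_def H" and "u \<noteq> 0"
  shows "BB_alpha H (mat 1) u \<in> {inverse (lambda_max H)..inverse (lambda_min H)}"
proof -
  have sym: "transpose H = H" and pos: "u \<bullet> (H *v u) > 0"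
    using assms by (auto simp: sym_pos_def_def)
  have uu: "u \<bullet> u > 0" using \<open>u \<noteq> 0\<close> by simp
  have "0 < lambda_max H * (u \<bullet> u)"
    using rayleigh_le_lambda_max[OF sym, of u] pos by linarith
  then have "lambda_max H > 0" using uu by (simp add: zero_less_mult_iff)
  then show ?thesis
    using rayleigh_le_lambda_max[OF sym, of u] rayleigh_ge_lambda_min[OF sym, of u]
      lambda_min_pos[OF H] pos
    by (simp add: BB_alpha_def field_simps)
qed

lemma BB_cone_linear_image:
  fixes H A :: "real^'n^'n"
  assumes "A ** H = H ** A"
  shows "diag_action A \<in> BB_cone H \<rightarrow> BB_cone H"
proof -
  have "A *v (H *v x) = H *v (A *v x)" for x
    using assms by (simp add: matrix_vector_mul_assoc)
  then show ?thesis
    by (auto simp: diag_action_def BB_cone_def shifted_matrix_apply matrix_vector_mult_diff_distrib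
        matrix_vector_mult_scaleR)
qed

lemma linear_diag_action: "linear (diag_action A)"
  by (rule linearI)
    (auto simp: diag_action_def matrix_vector_right_distrib matrix_vector_mult_scaleR)

text \<open>The cone is the projection of a closed set along the compact interval of step sizes.\<close>

lemma closed_BB_cone:
  fixes H :: "real^'n^'n"
  shows "closed (BB_cone H)"
proof -
  let ?K = "{inverse (lambda_max H)..inverse (lambda_min H)}"
  let ?g = "\<lambda>p::real \<times> ((real^'n) \<times> (real^'n)).
    snd (snd p) - (fst (snd p) - fst p *\<^sub>R (H *v fst (snd p)))"
  let ?C = "(?K \<times> UNIV) \<inter> {p. ?g p = 0}"
  have "continuous_on UNIV ?g"
    by (intro continuous_intros)
  then have "closed {p. ?g p = 0}"
    by (intro closed_Collect_eq continuous_intros)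
  then have "closedin (top_of_set (?K \<times> UNIV)) ?C"
    by (rule closedin_closed_Int)
  then have "closedin (top_of_set UNIV) (snd ` ?C)"
    by (rule Starlike.closed_map_snd[OF compact_Icc])
  moreover have "snd ` ?C = BB_cone H"
  proof
    show "snd ` ?C \<subseteq> BB_cone H"
      by (auto simp: BB_cone_def shifted_matrix_apply)
    show "BB_cone H \<subseteq> snd ` ?C"
    proof
      fix p assume "p \<in> BB_cone H"
      then obtain u \<alpha> where "p = (u, u - \<alpha> *\<^sub>R (H *v u))" "\<alpha> \<in> ?K"
        unfolding BB_cone_def shifted_matrix_apply by blast
      then show "p \<in> snd ` ?C"
        by (intro image_eqI[of _ _ "(\<alpha>, p)"]) auto
    qed
  qed
  ultimately show ?thesis by simp
qed

lemma BB_cone_fst_zero: "(0, v) \<in> BB_cone H \<Longrightarrow> v = 0"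
  by (auto simp: BB_cone_def)

text \<open>In general the step size has no limit as \<open>u\<close> tends to zero, but it stays bounded. Hence the transition is
  bounded by a multiple of the norm, which gives continuity at the apex.\<close>

lemma continuous_on_BB1_transition:
  fixes H :: "real^'n^'n"
  assumes H: "sym_pos_def H"
  shows "continuous_on (BB_cone H) (BB_transition H (mat 1))"
  unfolding continuous_on_eq_continuous_within
proof
  let ?T = "BB_transition H (mat 1)"
  fix p assume p: "p \<in> BB_cone H"
  show "continuous (at p within BB_cone H) ?T"
  proof (cases "fst p = 0")
    case False
    let ?U = "{q::(real^'n) \<times> (real^'n). fst q \<noteq> 0}"
    let ?f = "\<lambda>q. (snd q, snd q -
        ((fst q \<bullet> fst q) / (fst q \<bullet> (H *v fst q))) *\<^sub>R (H *v snd q))"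
    have U: "open ?U"
      by (intro open_Collect_neq continuous_intros)
    have "fst q \<bullet> (H *v fst q) \<noteq> 0" if "q \<in> ?U" for q
      using H that by (force simp: sym_pos_def_def)
    then have "continuous_on ?U ?f"
      by (intro continuous_intros) auto
    moreover have "?f q = ?T q" if "q \<in> ?U" for q
      using that by (auto simp: BB_transition_def BB_alpha_def shifted_matrix_apply split: prod.split)
    ultimately have "continuous_on ?U ?T"
      by (rule continuous_on_eq)
    then show ?thesis
      using U False continuous_on_eq_continuous_at
      by (blast intro: continuous_at_imp_continuous_at_within)
  next
    case True
    then have p0: "p = 0"
      using p BB_cone_fst_zero by (cases p) (auto simp: zero_prod_def)
    obtain K where K: "K > 0" "\<And>x. norm (H *v x) \<le> K * norm x"
      using linear_bounded_pos[of "(*v) H"] by auto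
    let ?c = "inverse (lambda_min H)"
    have bound: "norm (?T q) \<le> (2 + ?c * K) * norm q" for q
    proof (cases "fst q = 0")
      case True
      have "?c > 0" using lambda_min_pos[OF H] by simp
      with True K(1) show ?thesis
        by (auto simp: BB_transition_def zero_prod_def[symmetric] split: prod.split)
    next
      case False
      obtain u v where q: "q = (u, v)" by (cases q)
      let ?\<alpha> = "BB_alpha H (mat 1) u"
      have "u \<noteq> 0" using False q by simp
      then have "?\<alpha> \<le> ?c"
        using BB_alpha_bounds[OF H] by auto
      moreover have "0 \<le> ?\<alpha>"
        using H \<open>u \<noteq> 0\<close> by (simp add: BB_alpha_def sym_pos_def_def less_imp_le)
      ultimately have \<alpha>: "norm (?\<alpha> *\<^sub>R (H *v v)) \<le> ?c * (K * norm v)"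
        using K by (simp add: mult_mono')
      have "norm (?T q) \<le> norm v + norm (v - ?\<alpha> *\<^sub>R (H *v v))"
        using \<open>u \<noteq> 0\<close> q norm_Pair_le by (auto simp: BB_transition_def shifted_matrix_apply)
      also have "\<dots> \<le> norm v + (norm v + ?c * (K * norm v))"
        using norm_triangle_ineq4[of v "?\<alpha> *\<^sub>R (H *v v)"] \<alpha> by linarith
      also have "\<dots> = (2 + ?c * K) * norm v"
        by (simp add: algebra_simps)
      also have "\<dots> \<le> (2 + ?c * K) * norm q"
        using K(1) lambda_min_pos[OF H] q by (intro mult_left_mono) (auto simp: norm_snd_le)
      finally show ?thesis .
    qed
    have "(?T \<longlongrightarrow> 0) (at 0 within BB_cone H)"
    proof (rule Lim_null_comparison[OF always_eventually])
      show "\<forall>q. norm (?T q) \<le> (2 + ?c * K) * norm q" using bound by blast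
      show "((\<lambda>q. (2 + ?c * K) * norm q) \<longlongrightarrow> 0) (at 0 within BB_cone H)"
        by (auto intro!: tendsto_eq_intros)
    qed
    moreover have "?T 0 = 0"
      by (simp add: BB_transition_def zero_prod_def)
    ultimately show ?thesis
      by (simp add: p0 continuous_within)
  qed
qed

lemma homogeneous_cone_map_BB1:
  fixes H :: "real^'n^'n"
  assumes H: "sym_pos_def H"
  shows "homogeneous_cone_map (BB_cone H) (BB_transition H (mat 1))"
proof -
  let ?T = "BB_transition H (mat 1)"
  obtain u :: "real^'n" where u: "u \<noteq> 0"
    by (metis axis_eq_0_iff zero_neq_one)
  have interval: "inverse (lambda_max H) \<in> {inverse (lambda_max H)..inverse (lambda_min H)}"
    using BB_alpha_bounds[OF H u] by simp
  then have "(u, (mat 1 - inverse (lambda_max H) *\<^sub>R H) *v u) \<in> BB_cone H"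
    by (auto simp: BB_cone_def)
  then have "BB_cone H \<noteq> {0}"
    using u by (auto simp: zero_prod_def)
  moreover have zero: "0 \<in> BB_cone H"
    using interval by (auto simp: BB_cone_def zero_prod_def)
  moreover have "cone (BB_cone H)"
    by (auto simp: cone_def BB_cone_def matrix_vector_mult_scaleR)
  moreover have "?T \<in> BB_cone H \<rightarrow> BB_cone H"
  proof
    fix p assume "p \<in> BB_cone H"
    show "?T p \<in> BB_cone H"
    proof (cases "fst p = 0")
      case True
      with zero show ?thesis by (auto simp: BB_transition_def zero_prod_def split: prod.split)
    next
      case False
      with BB_alpha_bounds[OF H False] show ?thesis
        by (auto simp: BB_transition_def BB_cone_def split: prod.split)
    qed
  qed
  moreover have "?T (t *\<^sub>R p) = t *\<^sub>R ?T p" if "t \<ge> 0" for t p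
    using that by (cases "t = 0")
      (auto simp: BB_transition_def BB_alpha_def matrix_vector_mult_scaleR zero_prod_def
        split: prod.split)
  ultimately show ?thesis
    using closed_BB_cone continuous_on_BB1_transition[OF H] by (simp add: homogeneous_cone_map_def)
qed

section \<open>Spectral weights\<close>

text \<open>With \<open>W = S\<^sup>2\<close> and \<open>S\<close> symmetric and commuting with \<open>H\<close>, both the numerator \<open>u \<bullet> W u\<close>
  and the denominator \<open>u \<bullet> W H u\<close> of the weighted step size are the unweighted ones at \<open>S u\<close>.\<close>

lemma BB_alpha_square_weight:
  fixes H S :: "real^'n^'n"
  assumes sym: "transpose S = S" and comm: "S ** H = H ** S"
  shows "BB_alpha H (S ** S) u = BB_alpha H (mat 1) (S *v u)"
proof -
  have "S *v (H *v x) = H *v (S *v x)" for x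
    using comm by (simp add: matrix_vector_mul_assoc)
  then show ?thesis
    by (simp add: BB_alpha_def symmetric_matrix_inner[OF sym] flip: matrix_vector_mul_assoc)
qed

lemma diag_action_BB_transition:
  fixes H S :: "real^'n^'n"
  assumes sym: "transpose S = S" and comm: "S ** H = H ** S"
    and inj: "\<And>u. S *v u = 0 \<Longrightarrow> u = 0"
  shows "diag_action S (BB_transition H (S ** S) p) = BB_transition H (mat 1) (diag_action S p)"
proof -
  have "S *v (H *v x) = H *v (S *v x)" for x
    using comm by (simp add: matrix_vector_mul_assoc)
  then show ?thesis
    using inj by (auto simp: BB_transition_def diag_action_def BB_alpha_square_weight[OF sym comm]
        shifted_matrix_apply matrix_vector_mult_diff_distrib matrix_vector_mult_scaleR
        split: prod.split)
qed

theorem proposition3p2: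
  fixes H W S :: "real^'n^'n" and \<omega> :: "real \<Rightarrow> real"
  assumes "sym_pos_def H"
    and "\<forall>l\<in>spectrum H. \<omega> l > 0"
    and "W = matrix_fun \<omega> H"
    and "S = matrix_sqrt W"
  shows "homogeneous_cone_map (BB_cone H) (BB_transition H W)
    \<and> homogeneous_cone_map (BB_cone H) (BB_transition H (mat 1))
    \<and> bij_betw (diag_action S) (BB_cone H) (BB_cone H)
    \<and> (\<forall>p\<in>BB_cone H.
         diag_action S (BB_transition H W p) = BB_transition H (mat 1) (diag_action S p))
    \<and> (\<forall>p\<in>BB_cone H.
         BB_transition H W p =
           inv_into (BB_cone H) (diag_action S) (BB_transition H (mat 1) (diag_action S p)))
    \<and> growth_radius (BB_cone H) (BB_transition H W) =
        growth_radius (BB_cone H) (BB_transition H (mat 1))"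
proof -
  let ?\<Omega> = "BB_cone H" and ?T = "BB_transition H W" and ?T1 = "BB_transition H (mat 1)"
  have symH: "transpose H = H"
    using assms(1) by (simp add: sym_pos_def_def)
  \<comment> \<open>\<open>R\<close> is the inverse of \<open>S\<close>.\<close>
  define R where "R = matrix_fun (\<lambda>l. inverse (sqrt (\<omega> l))) H"
  have S: "S = matrix_fun (\<lambda>l. sqrt (\<omega> l)) H"
    using assms matrix_sqrt_matrix_fun[OF symH] by simp
  have pos: "sqrt (\<omega> l) * sqrt (\<omega> l) = \<omega> l" "sqrt (\<omega> l) \<noteq> 0" if "l \<in> spectrum H" for l
    using assms(2) that by (force simp: less_imp_le)+
  have W: "W = S ** S"
    using pos by (auto simp: S assms(3) matrix_fun_mult[OF symH] intro!: matrix_fun_cong)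
  have RS: "R ** S = mat 1" and SR: "S ** R = mat 1"
    using pos by (auto simp: R_def S matrix_fun_mult[OF symH] simp flip: matrix_fun_one[OF symH]
        intro!: matrix_fun_cong)
  have symS: "transpose S = S" and comm: "S ** H = H ** S" "R ** H = H ** R"
    by (simp_all add: S R_def transpose_matrix_fun matrix_fun_commute[OF symH])
  have inv: "diag_action R (diag_action S p) = p" "diag_action S (diag_action R p) = p" for p
    by (auto simp: diag_action_def matrix_vector_mul_assoc RS SR split: prod.split)
  have inj0: "u = 0" if "S *v u = 0" for u
    by (metis RS matrix_vector_mul_assoc matrix_vector_mul_lid matrix_vector_mult_0_right that)
  note mem = BB_cone_linear_image[OF comm(1)] BB_cone_linear_image[OF comm(2)]
  have conj: "diag_action S (?T p) = ?T1 (diag_action S p)" for p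
    unfolding W by (rule diag_action_BB_transition[OF symS comm(1) inj0])
  have T1: "homogeneous_cone_map ?\<Omega> ?T1"
    by (rule homogeneous_cone_map_BB1[OF assms(1)])
  have T: "homogeneous_cone_map ?\<Omega> ?T"
    by (rule homogeneous_cone_map_linear_conjugate[OF T1 linear_diag_action mem(1)
          linear_diag_action mem(2)])
      (metis conj inv(1))
  have bij: "bij_betw (diag_action S) ?\<Omega> ?\<Omega>"
    using mem inv by (intro bij_betw_byWitness[where f' = "diag_action R"]) auto
  have "?T p = inv_into ?\<Omega> (diag_action S) (?T1 (diag_action S p))" if "p \<in> ?\<Omega>" for p
  proof -
    have "?T p \<in> ?\<Omega>"
      using T that by (auto simp: homogeneous_cone_map_def)
    then show ?thesis
      using bij conj by (metis bij_betw_inv_into_left)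
  qed
  moreover have "growth_radius ?\<Omega> ?T = growth_radius ?\<Omega> ?T1"
    by (rule growth_radius_conjugate[OF T1 T linear_diag_action mem(1) linear_diag_action mem(2)])
      (simp_all add: inv conj)
  ultimately show ?thesis
    using T1 T bij conj by blast
qed

end
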